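(* Let $k$ be a field of characteristic zero, let $S=k[x_1,\ldots,x_n]$ be a polynomial ring graded by $\deg(x_i)=d_i>0$, and let $I\subseteq S$ be a strongly Golod monomial ideal. If $p,q$ are positive integers with $p\geq q$, then the ideal $I^{p/q}$ is strongly Golod.
   Context: For an ideal $I\subseteq S$, $\overline{I}$ denotes its integral closure. For positive integers $p,q$, the rational power is $I^{p/q}:=\{f\in S \mid f^q\in\overline{I^p}\}$; this is an ideal depending only on the rational number $p/q$, and for $p=q$ it equals $\overline{I}$ (not $I$). For an ideal $I\subseteq S$, $\partial(I)$ denotes the ideal of $S$ generated by all partial derivatives $\partial f/\partial x_i$ of elements $f\in I$, $i=1,\ldots,n$. A proper homogeneous ideal $I\subseteq S$ is called strongly Golod if $\partial(I)^2\subseteq I$. *)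

theory Defs
  imports HOL.Modules "HOL-Library.Poly_Mapping"
begin

text \<open>
  The polynomial ring \<open>k[x\<^sub>1, \<dots>, x\<^sub>n]\<close>: the variables are the elements of a finite type \<open>'n\<close>,
  a monomial is its exponent vector \<open>'n \<Rightarrow>\<^sub>0 nat\<close>, and a polynomial maps monomials to coefficients.
\<close>

type_synonym ('n, 'k) mpoly = "('n \<Rightarrow>\<^sub>0 nat) \<Rightarrow>\<^sub>0 'k"

text \<open>
  Ideals of a commutative ring are the submodules of the ring over itself: \<open>ideal.subspace I\<close>
  says that \<open>I\<close> is an ideal, and \<open>ideal.span A\<close> is the ideal generated by \<open>A\<close>.
\<close>

global_interpretation ideal: module "(*) :: 'a::comm_ring_1 \<Rightarrow> 'a \<Rightarrow> 'a"
  by unfold_locales (simp_all add: algebra_simps)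

definition ideal_prod :: "'a::comm_ring_1 set \<Rightarrow> 'a set \<Rightarrow> 'a set" where
  "ideal_prod I J = ideal.span {a * b | a b. a \<in> I \<and> b \<in> J}"

primrec ideal_power :: "'a::comm_ring_1 set \<Rightarrow> nat \<Rightarrow> 'a set" where
  "ideal_power I 0 = UNIV"
| "ideal_power I (Suc r) = ideal_prod I (ideal_power I r)"

definition integral_closure :: "'a::comm_ring_1 set \<Rightarrow> 'a set" where
  "integral_closure I = {f. \<exists>m a. 0 < m \<and> (\<forall>i\<in>{1..m}. a i \<in> ideal_power I i) \<and>
     f ^ m + (\<Sum>i=1..m. a i * f ^ (m - i)) = 0}"

definition rational_power :: "'a::comm_ring_1 set \<Rightarrow> nat \<Rightarrow> nat \<Rightarrow> 'a set" where
  "rational_power I p q = {f. f ^ q \<in> integral_closure (ideal_power I p)}"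

text \<open>
  The subtraction of exponent vectors below is truncated, but a monomial not involving
  \<open>x\<^sub>i\<close> contributes the coefficient 0.
\<close>

definition partial_deriv :: "'n \<Rightarrow> ('n, 'k::comm_ring_1) mpoly \<Rightarrow> ('n, 'k) mpoly" where
  "partial_deriv i f = (\<Sum>m\<in>Poly_Mapping.keys f.
     Poly_Mapping.single (m - Poly_Mapping.single i 1)
       (of_nat (Poly_Mapping.lookup m i) * Poly_Mapping.lookup f m))"

definition deriv_ideal :: "('n, 'k::comm_ring_1) mpoly set \<Rightarrow> ('n, 'k) mpoly set" where
  "deriv_ideal I = ideal.span {partial_deriv i f | i f. f \<in> I}"

definition monomial_ideal :: "('n, 'k::comm_ring_1) mpoly set \<Rightarrow> bool" where
  "monomial_ideal I \<longleftrightarrow> (\<exists>M. I = ideal.span ((\<lambda>m. Poly_Mapping.single m 1) ` M))"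

definition weighted_degree :: "('n::finite \<Rightarrow> nat) \<Rightarrow> ('n \<Rightarrow>\<^sub>0 nat) \<Rightarrow> nat" where
  "weighted_degree d m = (\<Sum>i\<in>UNIV. Poly_Mapping.lookup m i * d i)"

definition homogeneous :: "('n::finite \<Rightarrow> nat) \<Rightarrow> ('n, 'k::comm_ring_1) mpoly \<Rightarrow> bool" where
  "homogeneous d f \<longleftrightarrow> (\<exists>e. \<forall>m\<in>Poly_Mapping.keys f. weighted_degree d m = e)"

definition homogeneous_ideal :: "('n::finite \<Rightarrow> nat) \<Rightarrow> ('n, 'k::comm_ring_1) mpoly set \<Rightarrow> bool" where
  "homogeneous_ideal d I \<longleftrightarrow> (\<exists>F. (\<forall>f\<in>F. homogeneous d f) \<and> I = ideal.span F)"

definition strongly_golod :: "('n::finite \<Rightarrow> nat) \<Rightarrow> ('n, 'k::comm_ring_1) mpoly set \<Rightarrow> bool" where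
  "strongly_golod d I \<longleftrightarrow> ideal.subspace I \<and> I \<noteq> UNIV \<and> homogeneous_ideal d I \<and>
     ideal_power (deriv_ideal I) 2 \<subseteq> I"

end

theory Submission
  imports Defs "Jordan_Normal_Form.Char_Poly"
begin

text \<open>
  Write \<open>X\<^bsup>u\<^esup>\<close> for the monomial with exponent vector \<open>u\<close>, and \<open>J = I\<^bsup>p/q\<^esup>\<close>. The heart of the matter is the
  inclusion \<open>\<partial>(I\<^bsup>p/q\<^esup>) \<subseteq> I\<^bsup>p/q - 1/2\<^esup>\<close> (\<open>mon_diff_mem_rational_power\<close>). Squaring it gives
  \<open>\<partial>(J)\<^sup>2 \<subseteq> I\<^bsup>2p/q - 1\<^esup>\<close>, and \<open>2p/q - 1 \<ge> p/q\<close> because \<open>p \<ge> q\<close>.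
  
  For the inclusion, let \<open>X\<^bsup>u\<^esup> \<in> I\<close>, let \<open>\<alpha>\<close> be the exponent of \<open>x\<^sub>i\<close> in it and \<open>u'\<close> the vector \<open>u\<close>
  with its entry at \<open>i\<close> replaced by 0. Then \<open>X\<^bsup>2u'\<^esup> \<in> I\<^bsup>max(2-\<alpha>,0)\<^esup>\<close>: this is trivial for \<open>\<alpha> = 0\<close> and
  for \<open>\<alpha> \<ge> 2\<close>, and for \<open>\<alpha> = 1\<close> it is the strongly Golod property applied to the derivative
  \<open>X\<^bsup>u'\<^esup>\<close> of \<open>X\<^bsup>u\<^esup>\<close>. The loss of \<open>\<alpha>\<close> in the exponent is additive, so multiplying generators shows
  \<open>X\<^bsup>2b'\<^esup> \<in> I\<^bsup>2r-\<beta>\<^esup>\<close> for every \<open>X\<^bsup>b\<^esup> \<in> I\<^bsup>r\<^esup>\<close> with exponent \<open>\<beta>\<close> at \<open>i\<close> (\<open>drop_var_square_mem\<close>),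
  where powers with negative exponents are read as the whole ring. If
  \<open>X\<^bsup>a\<^esup> \<in> I\<^bsup>p/q\<^esup>\<close> has exponent \<open>\<alpha> \<ge> 1\<close> at \<open>i\<close>, this says \<open>X\<^bsup>a'\<^esup> \<in> I\<^bsup>p/q - \<alpha>/2\<^esup>\<close>. As
  \<open>a - e\<^sub>i = (1/\<alpha>) a' + (1 - 1/\<alpha>) a\<close>, the weighted average of the two exponents shows
  \<open>X\<^bsup>a - e\<^sub>i\<^esup> \<in> I\<^bsup>p/q - 1/2\<^esup>\<close>.
  
  This computation with monomials is legitimate because \<open>J\<close> is a monomial ideal and
  \<open>X\<^bsup>a\<^esup> \<in> J\<close> holds exactly if \<open>X\<^bsup>qma\<^esup> \<in> I\<^bsup>pm\<^esup>\<close> for some \<open>m > 0\<close> (\<open>mon_mem_rational_power_iff\<close>, from the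
  coefficients in an equation of integral dependence). That \<open>J\<close> is an ideal holds in every
  commutative ring: \<open>J\<close> consists of the elements integral over the filtration
  \<open>F\<^sub>j = I\<^bsup>\<lceil>pj/q\<rceil>\<^esup>\<close>, and integral elements are closed under sums by a graded form of the
  determinant trick (\<open>determinant_trick\<close>). That \<open>J\<close> is monomial holds because the substitutions
  \<open>x\<^sub>i \<mapsto> 2 x\<^sub>i\<close> preserve \<open>J\<close> and separate the monomials (\<open>torus_stable_imp_monomial_ideal\<close>).
\<close>

(* Read in a ring, this simplification rule re-associates products to the left and so loops
   with associativity and commutativity. *)
declare ideal.scale_scale [simp del]

section \<open>Powers of ideals\<close>

lemma subspace_ideal_power: "ideal.subspace (ideal_power I n)"
  by (cases n) (simp_all add: ideal_prod_def)

lemma ideal_prod_mem: "a \<in> I \<Longrightarrow> b \<in> J \<Longrightarrow> a * b \<in> ideal_prod I J"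
  unfolding ideal_prod_def by (rule ideal.span_base) blast

lemma ideal_prod_least:
  assumes "\<And>a b. a \<in> I \<Longrightarrow> b \<in> J \<Longrightarrow> a * b \<in> K" and "ideal.subspace K"
  shows "ideal_prod I J \<subseteq> K"
  unfolding ideal_prod_def by (rule ideal.span_minimal) (use assms in auto)

lemma subspace_ideal_prod: "ideal.subspace (ideal_prod I J)"
  by (simp add: ideal_prod_def)

lemma subspace_colon_ideal:
  assumes "ideal.subspace K"
  shows "ideal.subspace {x. \<forall>c\<in>C. x * c \<in> K}"
  by (rule ideal.subspaceI)
    (simp_all add: distrib_right mult.assoc ideal.subspace_0[OF assms] ideal.subspace_add[OF assms]
      ideal.subspace_scale[OF assms])

lemma ideal_prod_commute: "ideal_prod I J = ideal_prod J I"
  unfolding ideal_prod_def by (rule arg_cong[where f = ideal.span]) (metis mult.commute)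

lemma ideal_prod_assoc_subset: "ideal_prod (ideal_prod I J) K \<subseteq> ideal_prod I (ideal_prod J K)"
proof (rule ideal_prod_least)
  have "ideal_prod I J \<subseteq> {x. \<forall>c\<in>K. x * c \<in> ideal_prod I (ideal_prod J K)}"
    by (intro ideal_prod_least subspace_colon_ideal subspace_ideal_prod)
      (auto simp: mult.assoc intro: ideal_prod_mem)
  then show "a * b \<in> ideal_prod I (ideal_prod J K)" if "a \<in> ideal_prod I J" "b \<in> K" for a b
    using that by auto
qed (rule subspace_ideal_prod)

lemma ideal_prod_assoc: "ideal_prod (ideal_prod I J) K = ideal_prod I (ideal_prod J K)"
proof
  show "ideal_prod I (ideal_prod J K) \<subseteq> ideal_prod (ideal_prod I J) K"
    using ideal_prod_assoc_subset[of K J I] by (simp add: ideal_prod_commute)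
qed (rule ideal_prod_assoc_subset)

lemma ideal_prod_subset_right: "ideal.subspace J \<Longrightarrow> ideal_prod I J \<subseteq> J"
  by (rule ideal_prod_least) (auto intro: ideal.subspace_scale)

lemma ideal_prod_UNIV: "ideal.subspace J \<Longrightarrow> ideal_prod UNIV J = J"
  using ideal_prod_subset_right[of J UNIV] ideal_prod_mem[of 1 UNIV _ J] by auto

lemma ideal_power_add: "ideal_power I (m + n) = ideal_prod (ideal_power I m) (ideal_power I n)"
  by (induction m) (simp_all add: ideal_prod_UNIV subspace_ideal_power ideal_prod_assoc)

lemma ideal_power_mult: "ideal_power (ideal_power I m) n = ideal_power I (m * n)"
  by (induction n) (simp_all add: ideal_power_add)

lemma mult_mem_ideal_power:
  "x \<in> ideal_power I m \<Longrightarrow> y \<in> ideal_power I n \<Longrightarrow> x * y \<in> ideal_power I (m + n)"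
  unfolding ideal_power_add by (rule ideal_prod_mem)

lemma ideal_power_antimono: "m \<le> n \<Longrightarrow> ideal_power I n \<subseteq> ideal_power I m"
  by (induction rule: dec_induct)
    (use ideal_prod_subset_right[OF subspace_ideal_power] in fastforce)+

lemma power_mem_ideal_power: "x \<in> ideal_power I m \<Longrightarrow> x ^ n \<in> ideal_power I (m * n)"
  by (induction n) (simp_all add: mult_mem_ideal_power)

lemma ideal_prod_UNIV_right: "ideal.subspace I \<Longrightarrow> ideal_prod I UNIV = I"
  by (simp add: ideal_prod_commute[of I] ideal_prod_UNIV)

lemma ideal_power_two: "ideal.subspace I \<Longrightarrow> ideal_power I 2 = ideal_prod I I"
  by (simp add: numeral_2_eq_2 ideal_prod_UNIV_right)

lemma square_mem_ideal_power_two: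
  "ideal.subspace I \<Longrightarrow> x \<in> I \<Longrightarrow> x\<^sup>2 \<in> ideal_power I 2"
  by (simp add: ideal_power_two power2_eq_square ideal_prod_mem)

section \<open>Integrality over a filtration\<close>

text \<open>
  These are the properties of the powers of an ideal on which the theory of integral dependence
  rests. Other filtrations are needed in order to treat fractional exponents.
\<close>

locale ideal_filtration =
  fixes F :: "nat \<Rightarrow> 'a::comm_ring_1 set"
  assumes subspace: "ideal.subspace (F n)"
    and zero_UNIV: "F 0 = UNIV"
    and antimono: "m \<le> n \<Longrightarrow> F n \<subseteq> F m"
    and mult_mem: "x \<in> F m \<Longrightarrow> y \<in> F n \<Longrightarrow> x * y \<in> F (m + n)"

text \<open>
  For \<open>F = ideal_power I\<close> this is membership in the integral closure of \<open>I\<close>. In general it says that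
  \<open>f t\<close> is integral over the Rees ring \<open>\<Oplus> F\<^sub>n t\<^sup>n\<close>.
\<close>

definition integral_over :: "(nat \<Rightarrow> 'a::comm_ring_1 set) \<Rightarrow> 'a \<Rightarrow> bool" where
  "integral_over F f \<longleftrightarrow> (\<exists>m a. 0 < m \<and> (\<forall>i\<in>{1..m}. a i \<in> F i) \<and>
     f ^ m + (\<Sum>i=1..m. a i * f ^ (m - i)) = 0)"

context ideal_filtration
begin

lemma mem_mono: "x \<in> F n \<Longrightarrow> m \<le> n \<Longrightarrow> x \<in> F m"
  using antimono by blast

lemma mult_mem': "x \<in> F m \<Longrightarrow> y \<in> F n \<Longrightarrow> k \<le> m + n \<Longrightarrow> x * y \<in> F k"
  using mult_mem mem_mono by blast

text \<open>
  If the polynomial variable stands for a quantity of degree \<open>e\<close> and \<open>F n\<close> for the coefficients of degree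
  \<open>n\<close>, these are the polynomials that are homogeneous of degree \<open>t\<close>. The degree \<open>t\<close> is an integer since
  the degrees of matrix entries below may be negative; as \<open>F\<close> is decreasing, extending it by
  the whole ring in negative degrees keeps it multiplicative.
\<close>

definition rees_coeffs :: "nat \<Rightarrow> int \<Rightarrow> 'a poly set" where
  "rees_coeffs e t = {P. \<forall>l. coeff P l \<in> F (nat (t - int (e * l)))}"

lemma rees_coeffs_mult:
  assumes "P \<in> rees_coeffs e s" and "Q \<in> rees_coeffs e t"
  shows "P * Q \<in> rees_coeffs e (s + t)"
proof -
  have "coeff (P * Q) l \<in> F (nat (s + t - int (e * l)))" for l
    unfolding coeff_mult
  proof (rule ideal.subspace_sum[OF subspace])
    fix i assume "i \<in> {..l}"
    then have "e * l = e * i + e * (l - i)"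
      by (simp add: add_mult_distrib2[symmetric])
    then have "int (e * l) = int (e * i) + int (e * (l - i))"
      by (simp only: of_nat_add)
    then show "coeff P i * coeff Q (l - i) \<in> F (nat (s + t - int (e * l)))"
      using assms unfolding rees_coeffs_def by (intro mult_mem') auto
  qed
  then show ?thesis by (simp add: rees_coeffs_def)
qed

lemma rees_coeffs_prod:
  assumes "\<And>x. x \<in> A \<Longrightarrow> P x \<in> rees_coeffs e (t x)"
  shows "prod P A \<in> rees_coeffs e (sum t A)"
  using assms
proof (induction A rule: infinite_finite_induct)
  case empty
  then show ?case
    by (auto simp: rees_coeffs_def zero_UNIV coeff_1 ideal.subspace_0[OF subspace])
next
  case (infinite A)
  then show ?case
    by (auto simp: rees_coeffs_def zero_UNIV coeff_1 ideal.subspace_0[OF subspace])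
qed (simp add: rees_coeffs_mult)

text \<open>
  Let \<open>C\<close> be homogeneous of degree \<open>e\<close> as a map between basis vectors of degrees \<open>d i\<close>. Then
  each entry \<open>(i, j)\<close> of \<open>X - C\<close> is homogeneous of degree \<open>d i + e - d j\<close>, and in every summand of
  the Leibniz formula the contributions of \<open>d\<close> cancel, which leaves degree \<open>n e\<close>.
\<close>

lemma coeff_char_poly_mem:
  assumes C: "C \<in> carrier_mat n n"
    and mem: "\<And>i j. i < n \<Longrightarrow> j < n \<Longrightarrow> C $$ (i, j) \<in> F (d i + e - d j)"
  shows "coeff (char_poly C) l \<in> F (e * (n - l))"
proof -
  let ?M = "char_poly_matrix C"
  have M: "?M \<in> carrier_mat n n" using C by simp
  have entry: "?M $$ (i, j) \<in> rees_coeffs e (int (d i) + int e - int (d j))"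
    if ij: "i < n" "j < n" for i j
  proof -
    have "- C $$ (i, j) \<in> F (nat (int (d i) + int e - int (d j)))"
      using ideal.subspace_neg[OF subspace mem[OF ij]]
      by (simp add: nat_diff_distrib' nat_add_distrib)
    then show ?thesis
      using C ij
      by (auto simp: char_poly_matrix_def rees_coeffs_def zero_UNIV coeff_pCons
          ideal.subspace_0[OF subspace] split: nat.split)
  qed
  have "char_poly C \<in> rees_coeffs e (int (e * n))"
  proof -
    have summand: "signof p * (\<Prod>i=0..<n. ?M $$ (i, p i)) \<in> rees_coeffs e (int (e * n))"
      if p: "p permutes {0..<n}" for p
    proof -
      have "(\<Prod>i=0..<n. ?M $$ (i, p i)) \<in> rees_coeffs e (\<Sum>i=0..<n. int (d i) + int e - int (d (p i)))"
        using permutes_in_image[OF p] by (intro rees_coeffs_prod entry) auto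
      also have "(\<Sum>i=0..<n. int (d i) + int e - int (d (p i))) = int (e * n)"
        using sum.permute[OF p, of "\<lambda>i. int (d i)"]
        by (simp add: sum_subtractf sum.distrib o_def)
      finally show ?thesis
        by (cases p rule: sign_cases)
          (auto simp: rees_coeffs_def intro: ideal.subspace_neg[OF subspace])
    qed
    then show ?thesis
      unfolding char_poly_def det_def'[OF M] rees_coeffs_def
      by (auto simp: coeff_sum intro!: ideal.subspace_sum[OF subspace])
  qed
  moreover have "nat (int x - int y) = x - y" for x y by simp
  ultimately show ?thesis
    by (simp only: rees_coeffs_def mem_Collect_eq right_diff_distrib')
qed

text \<open>
  The vector \<open>v\<close> lies in the kernel of \<open>h - C\<close>; multiplying by the adjugate gives
  \<open>det (h - C) v = 0\<close>.
\<close>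

lemma char_poly_annihilates:
  fixes C :: "'b::comm_ring_1 mat"
  assumes C: "C \<in> carrier_mat n n"
    and eig: "\<And>i. i < n \<Longrightarrow> h * v i = (\<Sum>j<n. C $$ (i, j) * v j)"
    and k: "k < n"
  shows "poly (char_poly C) h * v k = 0"
proof -
  define B where "B = h \<cdot>\<^sub>m 1\<^sub>m n - C"
  define w where "w = vec n v"
  have B: "B \<in> carrier_mat n n" and w: "w \<in> carrier_vec n"
    using C by (auto simp: B_def w_def)
  have det: "poly (char_poly C) h = det B"
    unfolding char_poly_def
    by (rule poly_det_cong[OF B]) (use C in \<open>auto simp: char_poly_matrix_def B_def\<close>)
  have "B *\<^sub>v w = 0\<^sub>v n"
  proof
    fix i assume i: "i < dim_vec (0\<^sub>v n :: 'b vec)"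
    have "(B *\<^sub>v w) $ i = (\<Sum>j=0..<n. ((if i = j then h else 0) - C $$ (i, j)) * v j)"
      using C i by (auto simp: B_def w_def scalar_prod_def intro!: sum.cong)
    also have "\<dots> = h * v i - (\<Sum>j<n. C $$ (i, j) * v j)"
      using i by (simp add: left_diff_distrib sum_subtractf if_distrib[where f = "\<lambda>x. x * _"]
          atLeast0LessThan cong: if_cong)
    finally show "(B *\<^sub>v w) $ i = 0\<^sub>v n $ i" using i eig by simp
  qed (use B in auto)
  then have "(adj_mat B * B) *\<^sub>v w = 0\<^sub>v n"
    using B w adj_mat(1)[OF B] by (auto simp: assoc_mult_mat_vec[of _ n n _ n])
  then have "(det B \<cdot>\<^sub>m 1\<^sub>m n *\<^sub>v w) $ k = 0"
    using k by (simp add: adj_mat(3)[OF B])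
  then show ?thesis
    using k w by (simp add: det w_def)
qed

text \<open>
  The elements \<open>v a\<close> generate a graded module, with \<open>v a\<close> in degree \<open>d a\<close>, on which \<open>h\<close> acts
  with degree \<open>e\<close>. The characteristic polynomial of this action is the required equation for \<open>h\<close>,
  since it kills the element 1 of the module.
\<close>

lemma determinant_trick:
  assumes "finite A" and "a0 \<in> A" and "v a0 = 1"
    and span: "\<And>a. a \<in> A \<Longrightarrow>
      \<exists>c. (\<forall>b\<in>A. c b \<in> F (d a + e - d b)) \<and> h * v a = (\<Sum>b\<in>A. c b * v b)"
  shows "integral_over (\<lambda>l. F (e * l)) h"
proof -
  obtain \<phi> where \<phi>: "bij_betw \<phi> {0..<card A} A"
    using ex_bij_betw_nat_finite[OF \<open>finite A\<close>] by blast
  define n where "n = card A"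
  have \<phi>': "bij_betw \<phi> {..<n} A" using \<phi> by (simp add: n_def atLeast0LessThan)
  have \<phi>_in: "\<phi> i \<in> A" if "i < n" for i using \<phi>' that bij_betwE by fastforce
  have "0 < n" using assms(1,2) unfolding n_def by (auto simp: card_gt_0_iff)
  obtain k where k: "k < n" "\<phi> k = a0"
    using \<phi>' \<open>a0 \<in> A\<close> by (metis bij_betw_iff_bijections lessThan_iff)
  from span obtain c where c: "\<And>a b. a \<in> A \<Longrightarrow> b \<in> A \<Longrightarrow> c a b \<in> F (d a + e - d b)"
    and hv: "\<And>a. a \<in> A \<Longrightarrow> h * v a = (\<Sum>b\<in>A. c a b * v b)"
    by metis
  define C where "C = mat n n (\<lambda>(i, j). c (\<phi> i) (\<phi> j))"
  have C: "C \<in> carrier_mat n n" by (simp add: C_def)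
  let ?p = "char_poly C"
  have "poly ?p h * v (\<phi> k) = 0"
  proof (rule char_poly_annihilates[OF C _ k(1), of h "\<lambda>i. v (\<phi> i)"])
    fix i assume i: "i < n"
    show "h * v (\<phi> i) = (\<Sum>j<n. C $$ (i, j) * v (\<phi> j))"
      unfolding hv[OF \<phi>_in[OF i]] sum.reindex_bij_betw[OF \<phi>', symmetric]
      using i by (simp add: C_def)
  qed
  then have "poly ?p h = 0" using k assms(3) by simp
  moreover have "poly ?p h = h ^ n + (\<Sum>i=1..n. coeff ?p (n - i) * h ^ (n - i))"
  proof -
    have "poly ?p h = (\<Sum>i\<le>n. coeff ?p i * h ^ i)"
      using degree_monic_char_poly[OF C] by (simp add: poly_altdef)
    also have "\<dots> = (\<Sum>i\<le>n. coeff ?p (n - i) * h ^ (n - i))"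
      by (rule sum.nat_diff_reindex[of "\<lambda>i. coeff ?p i * h ^ i" "Suc n",
            unfolded lessThan_Suc_atMost, symmetric, simplified])
    also have "\<dots> = h ^ n + (\<Sum>i=1..n. coeff ?p (n - i) * h ^ (n - i))"
      using degree_monic_char_poly[OF C]
      by (simp add: sum.atMost_shift sum.atLeast1_atMost_eq)
    finally show ?thesis .
  qed
  moreover have "coeff ?p (n - i) \<in> F (e * i)" if "i \<in> {1..n}" for i
  proof -
    have "coeff ?p (n - i) \<in> F (e * (n - (n - i)))"
    proof (rule coeff_char_poly_mem[OF C, where d = "\<lambda>i. d (\<phi> i)"])
      show "C $$ (i, j) \<in> F (d (\<phi> i) + e - d (\<phi> j))" if "i < n" "j < n" for i j
        using that c \<phi>_in by (simp add: C_def)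
    qed
    then show ?thesis using that by simp
  qed
  ultimately show ?thesis
    using \<open>0 < n\<close> unfolding integral_over_def
    by (intro exI[of _ n] exI[of _ "\<lambda>i. coeff ?p (n - i)"]) auto
qed

text \<open>
  The module spanned by \<open>1, f, \<dots>, f\<^bsup>r-1\<^esup>\<close>, with \<open>f\<close> in degree 1, contains all powers of \<open>f\<close> in their
  proper degrees.
\<close>

definition powers_span :: "'a \<Rightarrow> nat \<Rightarrow> bool" where
  "powers_span f r \<longleftrightarrow> (\<forall>k. \<exists>c. (\<forall>i<r. c i \<in> F (k - i)) \<and> f ^ k = (\<Sum>i<r. c i * f ^ i))"

text \<open>
  The equation of integral dependence of degree \<open>r\<close> rewrites \<open>f\<^sup>r\<close> without leaving its degree; iterate.
\<close>

lemma integral_over_imp_powers_span: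
  assumes "integral_over F f"
  obtains r where "0 < r" and "powers_span f r"
proof -
  obtain r a where r: "0 < r" and a: "\<forall>i\<in>{1..r}. a i \<in> F i"
    and eq: "f ^ r + (\<Sum>i=1..r. a i * f ^ (r - i)) = 0"
    using assms unfolding integral_over_def by blast
  have fr: "f ^ r = (\<Sum>i<r. - a (r - i) * f ^ i)"
  proof -
    have "f ^ r = (\<Sum>i=1..r. - a i * f ^ (r - i))"
      using eq by (simp add: sum_negf eq_neg_iff_add_eq_0)
    also have "\<dots> = (\<Sum>i<r. - a (r - i) * f ^ i)"
      by (rule sum.reindex_bij_witness[of _ "\<lambda>i. r - i" "\<lambda>i. r - i"]) auto
    finally show ?thesis .
  qed
  have "\<exists>c. (\<forall>i<r. c i \<in> F (k - i)) \<and> f ^ k = (\<Sum>i<r. c i * f ^ i)" for k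
  proof (induction k)
    case 0
    have "f ^ 0 = (\<Sum>i<r. (if i = 0 then 1 else 0) * f ^ i)"
      using r by (simp add: if_distrib[where f = "\<lambda>x. x * _"] cong: if_cong)
    then show ?case
      by (intro exI[of _ "\<lambda>i. if i = 0 then 1 else 0"]) (simp add: zero_UNIV)
  next
    case (Suc k)
    then obtain c where c: "\<And>i. i < r \<Longrightarrow> c i \<in> F (k - i)"
      and fk: "f ^ k = (\<Sum>i<r. c i * f ^ i)" by blast
    obtain s where s: "r = Suc s" using r by (cases r) auto
    \<comment> \<open>Multiply the expression for \<open>f\<^sup>k\<close> by \<open>f\<close> and replace the top term \<open>c s * f\<^sup>r\<close>.\<close>
    define c' where "c' i = (if i = 0 then 0 else c (i - 1)) + c s * - a (r - i)" for i
    have "c' i \<in> F (Suc k - i)" if i: "i < r" for i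
      unfolding c'_def
    proof (rule ideal.subspace_add[OF subspace])
      show "(if i = 0 then 0 else c (i - 1)) \<in> F (Suc k - i)"
        using c[of "i - 1"] i by (cases i) (auto simp: ideal.subspace_0[OF subspace])
      show "c s * - a (r - i) \<in> F (Suc k - i)"
        using c[of s] a[rule_format, of "r - i"] i s
        by (intro mult_mem'[where m = "k - s" and n = "r - i"] ideal.subspace_neg[OF subspace]) auto
    qed
    moreover have "f ^ Suc k = (\<Sum>i<r. c' i * f ^ i)"
    proof -
      have "f ^ Suc k = (\<Sum>i<s. c i * f ^ Suc i) + c s * f ^ r"
        by (simp add: fk s sum_distrib_left algebra_simps)
      also have "(\<Sum>i<s. c i * f ^ Suc i) = (\<Sum>i<r. (if i = 0 then 0 else c (i - 1)) * f ^ i)"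
        unfolding s sum.lessThan_Suc_shift by simp
      also have "c s * f ^ r = (\<Sum>i<r. c s * - a (r - i) * f ^ i)"
        by (simp only: fr sum_distrib_left mult.assoc)
      finally show ?thesis
        by (simp only: c'_def distrib_right sum.distrib)
    qed
    ultimately show ?case by (intro exI[of _ c'] conjI allI impI)
  qed
  with r that show ?thesis by (auto simp: powers_span_def)
qed

text \<open>
  Passing to \<open>f\<^sup>e\<close> regrades the equation, which turns fractional exponents into integral ones.
  Multiplication by \<open>f\<^sup>e\<close> has degree \<open>e\<close> on the module spanned by the powers of \<open>f\<close>.
\<close>

lemma integral_over_power:
  assumes "integral_over F f"
  shows "integral_over (\<lambda>l. F (e * l)) (f ^ e)"
proof -
  obtain r where r: "0 < r" "powers_span f r"
    using integral_over_imp_powers_span[OF assms] .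
  show ?thesis
  proof (rule determinant_trick[where A = "{..<r}" and v = "\<lambda>i. f ^ i" and d = "\<lambda>i. i" and ?a0.0 = 0])
    fix i
    show "\<exists>c. (\<forall>j\<in>{..<r}. c j \<in> F (i + e - j)) \<and> f ^ e * f ^ i = (\<Sum>j<r. c j * f ^ j)"
      using r(2)[unfolded powers_span_def, rule_format, of "i + e"]
      by (auto simp: power_add mult.commute)
  qed (use r in auto)
qed

lemma powers_span_mult:
  assumes "powers_span f r" and "powers_span g s"
  shows "\<exists>c. (\<forall>b\<in>{..<r} \<times> {..<s}. c b \<in> F (k + l - (fst b + snd b))) \<and>
    f ^ k * g ^ l = (\<Sum>b\<in>{..<r} \<times> {..<s}. c b * (f ^ fst b * g ^ snd b))"
proof -
  obtain c where c: "\<And>i. i < r \<Longrightarrow> c i \<in> F (k - i)" and fk: "f ^ k = (\<Sum>i<r. c i * f ^ i)"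
    using assms(1) unfolding powers_span_def by blast
  obtain c' where c': "\<And>i. i < s \<Longrightarrow> c' i \<in> F (l - i)" and gl: "g ^ l = (\<Sum>i<s. c' i * g ^ i)"
    using assms(2) unfolding powers_span_def by blast
  have "f ^ k * g ^ l = (\<Sum>b\<in>{..<r} \<times> {..<s}. (c (fst b) * c' (snd b)) * (f ^ fst b * g ^ snd b))"
    unfolding fk gl sum_product sum.cartesian_product
    by (rule sum.cong) (auto simp: mult_ac)
  moreover have "c (fst b) * c' (snd b) \<in> F (k + l - (fst b + snd b))"
    if "b \<in> {..<r} \<times> {..<s}" for b
    using that by (intro mult_mem'[OF c c']) auto
  ultimately show ?thesis
    by (intro exI[of _ "\<lambda>b. c (fst b) * c' (snd b)"] conjI ballI)
qed

text \<open>
  Multiplication by \<open>f + g\<close> has degree 1 on the module spanned by the products \<open>f\<^sup>i g\<^sup>j\<close>.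
\<close>

lemma integral_over_add:
  assumes "integral_over F f" and "integral_over F g"
  shows "integral_over F (f + g)"
proof -
  obtain r where r: "0 < r" "powers_span f r"
    using integral_over_imp_powers_span[OF assms(1)] .
  obtain s where s: "0 < s" "powers_span g s"
    using integral_over_imp_powers_span[OF assms(2)] .
  let ?A = "{..<r} \<times> {..<s}" and ?v = "\<lambda>b. f ^ fst b * g ^ snd b"
  have "integral_over (\<lambda>l. F (1 * l)) (f + g)"
  proof (rule determinant_trick[where A = ?A and v = ?v and d = "\<lambda>b. fst b + snd b" and ?a0.0 = "(0, 0)"])
    fix a
    obtain c where c: "\<forall>b\<in>?A. c b \<in> F (Suc (fst a) + snd a - (fst b + snd b))"
      "f ^ Suc (fst a) * g ^ snd a = (\<Sum>b\<in>?A. c b * ?v b)"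
      using powers_span_mult[OF r(2) s(2)] by blast
    obtain c' where c': "\<forall>b\<in>?A. c' b \<in> F (fst a + Suc (snd a) - (fst b + snd b))"
      "f ^ fst a * g ^ Suc (snd a) = (\<Sum>b\<in>?A. c' b * ?v b)"
      using powers_span_mult[OF r(2) s(2)] by blast
    have "(f + g) * ?v a = (\<Sum>b\<in>?A. (c b + c' b) * ?v b)"
      using c(2) c'(2) by (simp add: algebra_simps sum.distrib)
    moreover have "\<forall>b\<in>?A. c b + c' b \<in> F (fst a + snd a + 1 - (fst b + snd b))"
      using c(1) c'(1) by (auto intro!: ideal.subspace_add[OF subspace])
    ultimately show "\<exists>c. (\<forall>b\<in>?A. c b \<in> F (fst a + snd a + 1 - (fst b + snd b))) \<and>
        (f + g) * ?v a = (\<Sum>b\<in>?A. c b * ?v b)"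
      by (intro exI[of _ "\<lambda>b. c b + c' b"] conjI)
  qed (use r s in auto)
  then show ?thesis by simp
qed

lemma integral_over_scale:
  assumes "integral_over F f"
  shows "integral_over F (x * f)"
proof -
  obtain m a where m: "0 < m" and a: "\<forall>i\<in>{1..m}. a i \<in> F i"
    and eq: "f ^ m + (\<Sum>i=1..m. a i * f ^ (m - i)) = 0"
    using assms unfolding integral_over_def by blast
  have "(x * f) ^ m + (\<Sum>i=1..m. x ^ i * a i * (x * f) ^ (m - i)) =
      x ^ m * (f ^ m + (\<Sum>i=1..m. a i * f ^ (m - i)))"
    by (auto simp: distrib_left sum_distrib_left power_mult_distrib intro!: sum.cong)
      (metis le_add_diff_inverse mult.assoc mult.left_commute power_add)
  then show ?thesis
    unfolding integral_over_def using m a eq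
    by (intro exI[of _ m] exI[of _ "\<lambda>i. x ^ i * a i"]) (auto intro: ideal.subspace_scale[OF subspace])
qed

lemma integral_over_zero: "integral_over F 0"
  unfolding integral_over_def
  by (intro exI[of _ 1] exI[of _ "\<lambda>_. 0"]) (auto simp: ideal.subspace_0[OF subspace])

lemma subspace_integral_over: "ideal.subspace {f. integral_over F f}"
  unfolding ideal.subspace_def
  by (auto intro: integral_over_zero integral_over_add integral_over_scale)

end

section \<open>Rational powers are ideals\<close>

text \<open>
  The exponent is \<open>\<lceil>pj/q\<rceil>\<close>. Rounding up makes the filtration multiplicative, because the ceiling is
  subadditive, and it is exact at multiples of \<open>q\<close>.
\<close>

definition rational_filtration :: "'a::comm_ring_1 set \<Rightarrow> nat \<Rightarrow> nat \<Rightarrow> nat \<Rightarrow> 'a set" where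
  "rational_filtration I p q j = ideal_power I ((p * j + (q - 1)) div q)"

lemma ceiling_div_add_le:
  fixes a b q :: nat
  assumes "0 < q"
  shows "(a + b + (q - 1)) div q \<le> (a + (q - 1)) div q + (b + (q - 1)) div q"
proof -
  have up: "x \<le> q * ((x + (q - 1)) div q)" for x
    using assms mod_less_divisor[of q "x + (q - 1)"] mult_div_mod_eq[of q "x + (q - 1)"] by linarith
  have "a + b + (q - 1) < q * ((a + (q - 1)) div q + (b + (q - 1)) div q + 1)"
    using up[of a] up[of b] assms unfolding add_mult_distrib2 by linarith
  then show ?thesis
    using assms by (metis Suc_eq_plus1 less_Suc_eq_le less_mult_imp_div_less mult.commute)
qed

lemma ideal_filtration_rational:
  assumes "0 < q"
  shows "ideal_filtration (rational_filtration I p q)"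
proof
  fix m n x y
  show "x * y \<in> rational_filtration I p q (m + n)"
    if "x \<in> rational_filtration I p q m" "y \<in> rational_filtration I p q n"
    using mult_mem_ideal_power[OF that[unfolded rational_filtration_def]]
      ideal_power_antimono[OF ceiling_div_add_le[OF assms, of "p * m" "p * n"], of I]
    by (auto simp: rational_filtration_def add_mult_distrib2)
  show "rational_filtration I p q n \<subseteq> rational_filtration I p q m" if "m \<le> n"
    unfolding rational_filtration_def using that
    by (intro ideal_power_antimono div_le_mono add_mono mult_le_mono) auto
qed (use assms in \<open>simp_all add: rational_filtration_def subspace_ideal_power\<close>)

lemma rational_filtration_multiple:
  assumes "0 < q"
  shows "rational_filtration I p q (q * i) = ideal_power (ideal_power I p) i"
proof -
  have "(p * (q * i) + (q - 1)) div q = p * i + (q - 1) div q"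
    using assms div_mult_self1[of q "q - 1" "p * i"] by (simp add: mult_ac add.commute)
  then show ?thesis using assms by (simp add: rational_filtration_def ideal_power_mult)
qed

text \<open>
  An equation for \<open>f\<^sup>q\<close> over \<open>I\<^sup>p\<close> is an equation for \<open>f\<close> over the rational filtration whose only
  nonzero coefficients sit in degrees divisible by \<open>q\<close>. The converse is \<open>integral_over_power\<close>.
\<close>

lemma rational_power_eq_integral_over:
  assumes q: "0 < q"
  shows "rational_power I p q = {f. integral_over (rational_filtration I p q) f}"
proof (intro equalityI subsetI CollectI)
  interpret ideal_filtration "rational_filtration I p q"
    using q by (rule ideal_filtration_rational)
  fix f assume "f \<in> {f. integral_over (rational_filtration I p q) f}"
  then have "integral_over (\<lambda>i. ideal_power (ideal_power I p) i) (f ^ q)"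
    using integral_over_power[of f q] q by (simp add: rational_filtration_multiple)
  then show "f \<in> rational_power I p q"
    by (simp add: rational_power_def integral_closure_def integral_over_def)
next
  interpret ideal_filtration "rational_filtration I p q"
    using q by (rule ideal_filtration_rational)
  fix f assume "f \<in> rational_power I p q"
  then obtain m a where m: "0 < m"
    and a: "\<forall>i\<in>{1..m}. a i \<in> ideal_power (ideal_power I p) i"
    and eq: "(f ^ q) ^ m + (\<Sum>i=1..m. a i * (f ^ q) ^ (m - i)) = 0"
    unfolding rational_power_def integral_closure_def by blast
  define b where "b j = (if q dvd j then a (j div q) else 0)" for j
  have "(\<Sum>i=1..m. a i * (f ^ q) ^ (m - i)) = (\<Sum>j\<in>(\<lambda>i. q * i) ` {1..m}. b j * f ^ (q * m - j))"
    using q by (subst sum.reindex)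
      (auto simp: inj_on_def b_def power_mult[symmetric] right_diff_distrib' intro!: sum.cong)
  also have "\<dots> = (\<Sum>j=1..q * m. b j * f ^ (q * m - j))"
  proof (rule sum.mono_neutral_left)
    show "\<forall>j\<in>{1..q * m} - (\<lambda>i. q * i) ` {1..m}. b j * f ^ (q * m - j) = 0"
      using q by (force simp: b_def elim!: dvdE)
  qed (use q in auto)
  finally have "f ^ (q * m) + (\<Sum>j=1..q * m. b j * f ^ (q * m - j)) = 0"
    using eq by (simp add: power_mult)
  moreover have "b j \<in> rational_filtration I p q j" if "j \<in> {1..q * m}" for j
    using that a[rule_format, of "j div q"] q
    by (auto simp: b_def rational_filtration_multiple ideal.subspace_0[OF subspace] elim!: dvdE)
  ultimately show "integral_over (rational_filtration I p q) f"
    using m q unfolding integral_over_def by (intro exI[of _ "q * m"] exI[of _ b]) auto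
qed

lemma subspace_rational_power:
  assumes "0 < q"
  shows "ideal.subspace (rational_power I p q)"
  unfolding rational_power_eq_integral_over[OF assms]
  by (rule ideal_filtration.subspace_integral_over[OF ideal_filtration_rational[OF assms]])

section \<open>Monomials\<close>

abbreviation mon :: "('n \<Rightarrow>\<^sub>0 nat) \<Rightarrow> ('n, 'k::comm_ring_1) mpoly" where
  "mon u \<equiv> Poly_Mapping.single u 1"

definition supported_on :: "(('n \<Rightarrow>\<^sub>0 nat) \<Rightarrow> bool) \<Rightarrow> ('n, 'k::comm_ring_1) mpoly set" where
  "supported_on R = {f. \<forall>u\<in>Poly_Mapping.keys f. R u}"

lemma lookup_const_mult:
  "Poly_Mapping.lookup (Poly_Mapping.single 0 c * f) u = c * Poly_Mapping.lookup f u"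
  by (simp add: Poly_Mapping.map.rep_eq when_def flip: mult_map_scale_conv_mult)

lemma mon_add: "mon (u + v) = mon u * (mon v :: ('n, 'k::comm_ring_1) mpoly)"
  by (simp add: mult_single)

lemma sum_single_keys:
  "(\<Sum>u\<in>Poly_Mapping.keys f. Poly_Mapping.single u (Poly_Mapping.lookup f u)) = f"
  by (rule poly_mapping_eqI)
    (simp add: lookup_sum lookup_single when_def sum.delta in_keys_iff)

lemma single_mem_ideal:
  "ideal.subspace J \<Longrightarrow> mon u \<in> J \<Longrightarrow> Poly_Mapping.single u c \<in> J"
  using ideal.subspace_scale[of J "mon u" "Poly_Mapping.single 0 c"] by (simp add: mult_single)

lemma supported_on_mem_subset:
  fixes J :: "('n, 'k::comm_ring_1) mpoly set"
  assumes "ideal.subspace J"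
  shows "supported_on (\<lambda>u. mon u \<in> J) \<subseteq> J"
proof
  fix f :: "('n, 'k) mpoly" assume f: "f \<in> supported_on (\<lambda>u. mon u \<in> J)"
  have "(\<Sum>u\<in>Poly_Mapping.keys f. Poly_Mapping.single u (Poly_Mapping.lookup f u)) \<in> J"
    using f unfolding supported_on_def
    by - (rule ideal.subspace_sum[OF assms], rule single_mem_ideal[OF assms], simp)
  then show "f \<in> J" by (simp only: sum_single_keys)
qed

lemma subspace_supported_on:
  assumes up: "\<And>u w. R u \<Longrightarrow> R (u + w)"
  shows "ideal.subspace (supported_on R)"
proof (rule ideal.subspaceI)
  show "x + y \<in> supported_on R" if "x \<in> supported_on R" "y \<in> supported_on R" for x y
    using that keys_add[of x y] unfolding supported_on_def by blast
  show "c * x \<in> supported_on R" if "x \<in> supported_on R" for c x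
    unfolding supported_on_def
  proof safe
    fix k assume "k \<in> Poly_Mapping.keys (c * x)"
    then obtain a b where "k = a + b" "b \<in> Poly_Mapping.keys x" using keys_mult[of c x] by blast
    then show "R k" using that up[of b a] by (simp add: supported_on_def add.commute)
  qed
qed (simp add: supported_on_def)

lemma mon_mem_add: "ideal.subspace J \<Longrightarrow> mon u \<in> J \<Longrightarrow> mon (u + w) \<in> J"
  by (metis add.commute mon_add ideal.subspace_scale)

lemma span_mon_subset:
  "ideal.span (mon ` M) \<subseteq> supported_on (\<lambda>u. mon u \<in> ideal.span (mon ` M))"
  by (intro ideal.span_minimal subspace_supported_on mon_mem_add ideal.subspace_span)
    (auto simp: supported_on_def intro: ideal.span_base)

text \<open>
  Working with this description avoids any choice of generators.
\<close>

lemma monomial_ideal_iff: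
  "monomial_ideal I \<longleftrightarrow> ideal.subspace I \<and> I \<subseteq> supported_on (\<lambda>u. mon u \<in> I)"
proof
  assume "monomial_ideal I"
  then show "ideal.subspace I \<and> I \<subseteq> supported_on (\<lambda>u. mon u \<in> I)"
    unfolding monomial_ideal_def using span_mon_subset by auto
next
  assume *: "ideal.subspace I \<and> I \<subseteq> supported_on (\<lambda>u. mon u \<in> I)"
  let ?S = "ideal.span (mon ` {u. mon u \<in> I})"
  have "?S \<subseteq> I" using * by (intro ideal.span_minimal) auto
  moreover have "supported_on (\<lambda>u. mon u \<in> I) \<subseteq> supported_on (\<lambda>u. mon u \<in> ?S)"
    by (auto simp: supported_on_def intro: ideal.span_base)
  then have "I \<subseteq> ?S"
    using * supported_on_mem_subset[OF ideal.subspace_span] by blast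
  ultimately show "monomial_ideal I" unfolding monomial_ideal_def by blast
qed

lemma ideal_prod_supported:
  assumes I: "monomial_ideal I" and J: "monomial_ideal J"
  shows "ideal_prod I J \<subseteq> supported_on (\<lambda>w. \<exists>u v. w = u + v \<and> mon u \<in> I \<and> mon v \<in> J)"
proof (rule ideal_prod_least)
  show "a * b \<in> supported_on (\<lambda>w. \<exists>u v. w = u + v \<and> mon u \<in> I \<and> mon v \<in> J)"
    if "a \<in> I" "b \<in> J" for a b
    using that I J keys_mult[of a b] unfolding monomial_ideal_iff supported_on_def by blast
  show "ideal.subspace (supported_on (\<lambda>w. \<exists>u v. w = u + v \<and> mon u \<in> I \<and> mon v \<in> J))"
    using J unfolding monomial_ideal_iff
    by (intro subspace_supported_on) (metis add.assoc mon_mem_add)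
qed

lemma monomial_ideal_power:
  assumes I: "monomial_ideal I"
  shows "monomial_ideal (ideal_power I r)"
proof (induction r)
  case 0
  show ?case by (auto simp: monomial_ideal_iff supported_on_def ideal.subspace_def)
next
  case (Suc r)
  have "ideal_prod I (ideal_power I r) \<subseteq> supported_on (\<lambda>w. mon w \<in> ideal_prod I (ideal_power I r))"
    using ideal_prod_supported[OF I Suc] by (fastforce simp: supported_on_def mon_add intro: ideal_prod_mem)
  then show ?case by (simp add: monomial_ideal_iff subspace_ideal_prod)
qed

lemma mon_mem_ideal_power_Suc:
  fixes I :: "('n, 'k::comm_ring_1) mpoly set"
  assumes I: "monomial_ideal I" and "mon w \<in> ideal_power I (Suc r)"
  obtains u v where "w = u + v" and "mon u \<in> I" and "mon v \<in> ideal_power I r"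
  using assms(2) ideal_prod_supported[OF I monomial_ideal_power[OF I], of r]
  by (fastforce simp: supported_on_def)

definition exponent_multiple :: "nat \<Rightarrow> ('n \<Rightarrow>\<^sub>0 nat) \<Rightarrow> ('n \<Rightarrow>\<^sub>0 nat)" where
  "exponent_multiple n u = (\<Sum>j<n. u)"

lemma lookup_exponent_multiple:
  "Poly_Mapping.lookup (exponent_multiple n u) i = n * Poly_Mapping.lookup u i"
  by (simp add: exponent_multiple_def lookup_sum)

lemma mon_exponent_multiple: "mon (exponent_multiple n u) = mon u ^ n"
  by (induction n) (simp_all add: exponent_multiple_def mon_add mult.commute)

section \<open>Rational powers of monomial ideals\<close>

lemma ideal_power_closed_under_hom:
  assumes add: "\<And>x y. \<phi> (x + y) = \<phi> x + \<phi> y" and mult: "\<And>x y. \<phi> (x * y) = \<phi> x * \<phi> y"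
    and I: "\<And>x. x \<in> I \<Longrightarrow> \<phi> x \<in> I"
    and "x \<in> ideal_power I n"
  shows "\<phi> x \<in> ideal_power I n"
  using assms(4)
proof (induction n arbitrary: x)
  case (Suc n)
  have zero: "\<phi> 0 = 0" using add[of 0 0] by simp
  have "ideal_prod I (ideal_power I n) \<subseteq> {x. \<phi> x \<in> ideal_prod I (ideal_power I n)}"
  proof (rule ideal_prod_least)
    show "ideal.subspace {x. \<phi> x \<in> ideal_prod I (ideal_power I n)}"
      using subspace_ideal_prod[of I "ideal_power I n"]
      by (auto simp: ideal.subspace_def zero add mult)
  qed (auto simp: mult intro!: ideal_prod_mem I Suc)
  then show ?case using Suc.prems by auto
qed simp

lemma rational_power_closed_under_hom:
  assumes add: "\<And>x y. \<phi> (x + y) = \<phi> x + \<phi> y" and mult: "\<And>x y. \<phi> (x * y) = \<phi> x * \<phi> y"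
    and one: "\<phi> 1 = 1" and I: "\<And>x. x \<in> I \<Longrightarrow> \<phi> x \<in> I"
    and f: "f \<in> rational_power I p q"
  shows "\<phi> f \<in> rational_power I p q"
proof -
  have zero: "\<phi> 0 = 0" using add[of 0 0] by simp
  have power: "\<phi> (x ^ n) = \<phi> x ^ n" for x n by (induction n) (simp_all add: one mult)
  have sum: "\<phi> (sum g A) = (\<Sum>i\<in>A. \<phi> (g i))" for g and A :: "nat set"
    by (induction A rule: infinite_finite_induct) (simp_all add: zero add)
  obtain m a where m: "0 < m" and a: "\<forall>i\<in>{1..m}. a i \<in> ideal_power (ideal_power I p) i"
    and eq: "(f ^ q) ^ m + (\<Sum>i=1..m. a i * (f ^ q) ^ (m - i)) = 0"
    using f unfolding rational_power_def integral_closure_def by blast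
  have "(\<phi> f ^ q) ^ m + (\<Sum>i=1..m. \<phi> (a i) * (\<phi> f ^ q) ^ (m - i)) = 0"
    using arg_cong[OF eq, of \<phi>] by (simp add: zero add mult power sum)
  moreover have "\<forall>i\<in>{1..m}. \<phi> (a i) \<in> ideal_power (ideal_power I p) i"
    using a ideal_power_closed_under_hom[of \<phi>, OF add mult I]
    unfolding ideal_power_mult by blast
  ultimately show ?thesis
    using m unfolding rational_power_def integral_closure_def
    by (auto intro!: exI[of _ m] exI[of _ "\<lambda>i. \<phi> (a i)"])
qed

text \<open>
  For a character \<open>\<chi>\<close> of the monoid of exponent vectors this is the action of a point of the torus.
\<close>

definition twist :: "(('n \<Rightarrow>\<^sub>0 nat) \<Rightarrow> 'k) \<Rightarrow> ('n, 'k::comm_ring_1) mpoly \<Rightarrow> ('n, 'k) mpoly" where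
  "twist \<chi> f = (\<Sum>u\<in>Poly_Mapping.keys f. Poly_Mapping.single u (\<chi> u * Poly_Mapping.lookup f u))"

lemma lookup_twist: "Poly_Mapping.lookup (twist \<chi> f) u = \<chi> u * Poly_Mapping.lookup f u"
  by (simp add: twist_def lookup_sum lookup_single when_def sum.delta in_keys_iff)

lemma twist_add: "twist \<chi> (f + g) = twist \<chi> f + twist \<chi> g"
  by (rule poly_mapping_eqI) (simp add: lookup_twist lookup_add distrib_left)

lemma twist_sum: "twist \<chi> (sum h A) = (\<Sum>a\<in>A. twist \<chi> (h a))"
  by (rule poly_mapping_eqI) (simp add: lookup_twist lookup_sum sum_distrib_left)

lemma twist_single: "twist \<chi> (Poly_Mapping.single u c) = Poly_Mapping.single u (\<chi> u * c)"
  by (rule poly_mapping_eqI) (simp add: lookup_twist lookup_single when_def)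

lemma twist_mult:
  assumes "\<And>u v. \<chi> (u + v) = \<chi> u * \<chi> v"
  shows "twist \<chi> (f * g) = twist \<chi> f * twist \<chi> g"
proof -
  have "twist \<chi> (f * g) = twist \<chi>
      ((\<Sum>u\<in>Poly_Mapping.keys f. Poly_Mapping.single u (Poly_Mapping.lookup f u)) *
       (\<Sum>v\<in>Poly_Mapping.keys g. Poly_Mapping.single v (Poly_Mapping.lookup g v)))"
    by (simp only: sum_single_keys)
  also have "\<dots> = twist \<chi> f * twist \<chi> g"
    unfolding sum_product twist_sum mult_single twist_single assms
    by (simp add: twist_def[of \<chi> f] twist_def[of \<chi> g] sum_product mult_single mult_ac)
  finally show ?thesis .
qed

lemma keys_twist_subset: "Poly_Mapping.keys (twist \<chi> f) \<subseteq> Poly_Mapping.keys f"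
  by (auto simp: in_keys_iff lookup_twist)

lemma twist_mem_monomial_ideal:
  assumes "monomial_ideal I" and "f \<in> I"
  shows "twist \<chi> f \<in> I"
  using assms keys_twist_subset[of \<chi> f] supported_on_mem_subset[of I]
  unfolding monomial_ideal_iff supported_on_def by blast

text \<open>
  The monomials are the joint eigenvectors of the substitutions \<open>x\<^sub>i \<mapsto> 2 x\<^sub>i\<close>, and in characteristic
  zero different monomials are separated by some eigenvalue. Subtracting a multiple of \<open>f\<close> from its
  image therefore removes one chosen monomial from \<open>f\<close> and keeps another one, so that induction
  on the number of monomials isolates each of them.
\<close>

lemma torus_stable_imp_monomial_ideal:
  fixes J :: "('n, 'k::field_char_0) mpoly set"
  assumes J: "ideal.subspace J"
    and stable: "\<And>f i. f \<in> J \<Longrightarrow> twist (\<lambda>u. 2 ^ Poly_Mapping.lookup u i) f \<in> J"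
  shows "monomial_ideal J"
proof -
  have "mon u \<in> J" if "f \<in> J" and "u \<in> Poly_Mapping.keys f" for f u
    using that
  proof (induction "card (Poly_Mapping.keys f)" arbitrary: f rule: less_induct)
    case less
    let ?c = "Poly_Mapping.lookup f u"
    have c: "?c \<noteq> 0" using less.prems by (simp add: in_keys_iff)
    show ?case
    proof (cases "Poly_Mapping.keys f = {u}")
      case True
      then have f: "f = Poly_Mapping.single u ?c" using sum_single_keys[of f] by simp
      have "Poly_Mapping.single 0 (inverse ?c) * f \<in> J"
        by (rule ideal.subspace_scale[OF J less.prems(1)])
      also have "Poly_Mapping.single 0 (inverse ?c) * f = mon u"
        by (subst f) (simp add: mult_single c)
      finally show ?thesis .
    next
      case False
      then obtain v where v: "v \<in> Poly_Mapping.keys f" "v \<noteq> u" using less.prems by blast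
      then obtain i where i: "Poly_Mapping.lookup v i \<noteq> Poly_Mapping.lookup u i"
        using poly_mapping_eqI[of v u] by blast
      let ?\<chi> = "\<lambda>w. 2 ^ Poly_Mapping.lookup w i :: 'k"
      have inj: "?\<chi> u \<noteq> ?\<chi> v"
        using i of_nat_eq_iff[where 'a = 'k, of "2 ^ Poly_Mapping.lookup u i" "2 ^ Poly_Mapping.lookup v i"]
        by simp
      \<comment> \<open>\<open>twist\<close> multiplies the monomial \<open>v\<close> by \<open>?\<chi> v\<close>, so \<open>v\<close> cancels in \<open>g\<close> while \<open>u\<close> survives.\<close>
      define g where "g = twist ?\<chi> f - Poly_Mapping.single 0 (?\<chi> v) * f"
      have lookup_g: "Poly_Mapping.lookup g w = (?\<chi> w - ?\<chi> v) * Poly_Mapping.lookup f w" for w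
        by (simp add: g_def lookup_minus lookup_twist left_diff_distrib lookup_const_mult)
      have "g \<in> J"
        unfolding g_def
        by (intro ideal.subspace_diff[OF J] stable ideal.subspace_scale[OF J] less.prems)
      moreover have "u \<in> Poly_Mapping.keys g" using c inj by (simp add: in_keys_iff lookup_g)
      moreover have "card (Poly_Mapping.keys g) < card (Poly_Mapping.keys f)"
      proof (rule psubset_card_mono[OF finite_keys psubsetI])
        show "Poly_Mapping.keys g \<subseteq> Poly_Mapping.keys f" by (auto simp: in_keys_iff lookup_g)
        have "v \<notin> Poly_Mapping.keys g" by (simp add: in_keys_iff lookup_g)
        then show "Poly_Mapping.keys g \<noteq> Poly_Mapping.keys f" using v(1) by metis
      qed
      ultimately show ?thesis by (intro less.hyps)
    qed
  qed
  then show ?thesis using J by (auto simp: monomial_ideal_iff supported_on_def)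
qed

lemma monomial_ideal_rational_power:
  fixes I :: "('n, 'k::field_char_0) mpoly set"
  assumes I: "monomial_ideal I" and q: "0 < q"
  shows "monomial_ideal (rational_power I p q)"
proof (rule torus_stable_imp_monomial_ideal[OF subspace_rational_power[OF q]])
  fix f i assume f: "f \<in> rational_power I p q"
  let ?\<chi> = "\<lambda>u :: 'n \<Rightarrow>\<^sub>0 nat. 2 ^ Poly_Mapping.lookup u i :: 'k"
  have "twist ?\<chi> 1 = 1"
    using twist_single[of ?\<chi> 0 1] by simp
  then show "twist ?\<chi> f \<in> rational_power I p q"
    by (intro rational_power_closed_under_hom[OF _ _ _ _ f] twist_add twist_mult
        twist_mem_monomial_ideal[OF I]) (simp_all add: lookup_add power_add)
qed

text \<open>
  In an equation of integral dependence for the monomial \<open>X\<^bsup>qu\<^esup>\<close> over \<open>I\<^sup>p\<close>, the coefficient at the exponent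
  of the leading term must cancel against some later term. As powers of a monomial ideal are monomial,
  that term alone yields \<open>X\<^bsup>qiu\<^esup> \<in> I\<^bsup>pi\<^esup>\<close>. Conversely, such a membership is a purely binomial equation.
\<close>

lemma mon_mem_rational_power_iff:
  fixes I :: "('n, 'k::comm_ring_1) mpoly set"
  assumes I: "monomial_ideal I"
  shows "mon u \<in> rational_power I p q \<longleftrightarrow> (\<exists>m>0. mon u ^ (q * m) \<in> ideal_power I (p * m))"
proof
  assume "\<exists>m>0. mon u ^ (q * m) \<in> ideal_power I (p * m)"
  then obtain m where m: "0 < m" and mem: "mon u ^ (q * m) \<in> ideal_power I (p * m)" by blast
  \<comment> \<open>the equation \<open>T\<^sup>m - X\<^bsup>qmu\<^esup> = 0\<close> for \<open>T = X\<^bsup>qu\<^esup>\<close>\<close>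
  define a where "a i = (if i = m then - (mon u ^ (q * m)) else 0 :: ('n, 'k) mpoly)" for i
  have "(mon u ^ q) ^ m + (\<Sum>i=1..m. a i * (mon u ^ q) ^ (m - i)) = 0"
    using m by (simp add: a_def if_distrib[where f = "\<lambda>x. x * _"] power_mult sum.delta cong: if_cong)
  moreover have "\<forall>i\<in>{1..m}. a i \<in> ideal_power (ideal_power I p) i"
    using mem by (auto simp: a_def ideal_power_mult
        intro: ideal.subspace_neg ideal.subspace_0 subspace_ideal_power)
  ultimately show "mon u \<in> rational_power I p q"
    using m unfolding rational_power_def integral_closure_def by blast
next
  assume "mon u \<in> rational_power I p q"
  then obtain m a where a: "\<forall>i\<in>{1..m}. a i \<in> ideal_power (ideal_power I p) i"
    and eq: "(mon u ^ q) ^ m + (\<Sum>i=1..m. a i * (mon u ^ q) ^ (m - i)) = 0"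
    unfolding rational_power_def integral_closure_def by blast
  let ?w = "\<lambda>n. exponent_multiple n u"
  have eq': "mon (?w (q * m)) + (\<Sum>i=1..m. a i * mon (?w (q * (m - i)))) = 0"
    using eq by (simp only: mon_exponent_multiple power_mult)
  have "1 + (\<Sum>i=1..m. Poly_Mapping.lookup (a i * mon (?w (q * (m - i)))) (?w (q * m))) = 0"
    using arg_cong[OF eq', of "\<lambda>f. Poly_Mapping.lookup f (?w (q * m))"]
    by (simp add: lookup_add lookup_sum)
  then have "(\<Sum>i=1..m. Poly_Mapping.lookup (a i * mon (?w (q * (m - i)))) (?w (q * m))) \<noteq> 0"
    by auto
  then obtain i where i: "i \<in> {1..m}"
    and "Poly_Mapping.lookup (a i * mon (?w (q * (m - i)))) (?w (q * m)) \<noteq> 0"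
    by (rule sum.not_neutral_contains_not_neutral)
  then have "?w (q * m) \<in> Poly_Mapping.keys (a i * mon (?w (q * (m - i))))"
    by (simp add: in_keys_iff)
  then obtain k where k: "k \<in> Poly_Mapping.keys (a i)" "?w (q * m) = k + ?w (q * (m - i))"
    using keys_mult[of "a i" "mon (?w (q * (m - i)))"] by auto
  have "k = ?w (q * i)"
  proof (rule poly_mapping_eqI)
    fix j
    have "q * m = q * i + q * (m - i)" using i by (simp flip: add_mult_distrib2)
    then show "Poly_Mapping.lookup k j = Poly_Mapping.lookup (?w (q * i)) j"
      using arg_cong[OF k(2), of "\<lambda>w. Poly_Mapping.lookup w j"]
      by (simp add: lookup_add lookup_exponent_multiple add_mult_distrib)
  qed
  moreover have "mon k \<in> ideal_power I (p * i)"
    using a i k(1) monomial_ideal_power[OF I, of "p * i"]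
    unfolding monomial_ideal_iff supported_on_def ideal_power_mult by blast
  ultimately show "\<exists>m>0. mon u ^ (q * m) \<in> ideal_power I (p * m)"
    using i by (intro exI[of _ i]) (simp add: mon_exponent_multiple)
qed

section \<open>Derivatives and the strongly Golod property\<close>

lemma partial_deriv_mon:
  "partial_deriv i (mon u) = Poly_Mapping.single (u - Poly_Mapping.single i 1)
     (of_nat (Poly_Mapping.lookup u i) :: 'k::comm_ring_1)"
  by (simp add: partial_deriv_def)

lemma keys_partial_deriv:
  assumes "k \<in> Poly_Mapping.keys (partial_deriv i f)"
  obtains u where "u \<in> Poly_Mapping.keys f" and "0 < Poly_Mapping.lookup u i"
    and "k = u - Poly_Mapping.single i 1"
proof -
  have "(\<Sum>m\<in>Poly_Mapping.keys f. Poly_Mapping.lookup (Poly_Mapping.single (m - Poly_Mapping.single i 1)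
       (of_nat (Poly_Mapping.lookup m i) * Poly_Mapping.lookup f m)) k) \<noteq> 0"
    using assms by (simp add: partial_deriv_def in_keys_iff lookup_sum)
  then obtain m where m: "m \<in> Poly_Mapping.keys f"
    "Poly_Mapping.lookup (Poly_Mapping.single (m - Poly_Mapping.single i 1)
       (of_nat (Poly_Mapping.lookup m i) * Poly_Mapping.lookup f m)) k \<noteq> 0"
    by (rule sum.not_neutral_contains_not_neutral)
  show ?thesis
  proof (rule that[OF m(1)])
    show "0 < Poly_Mapping.lookup m i" using m(2) by (cases "Poly_Mapping.lookup m i") auto
    show "k = m - Poly_Mapping.single i 1" using m(2) by (auto simp: lookup_single when_def split: if_splits)
  qed
qed

text \<open>
  Characteristic zero enters here: the exponent that differentiation brings down is invertible.
\<close>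

lemma mon_diff_mem_deriv_ideal:
  fixes I :: "('n, 'k::field_char_0) mpoly set"
  assumes "mon u \<in> I" and "0 < Poly_Mapping.lookup u i"
  shows "mon (u - Poly_Mapping.single i 1) \<in> deriv_ideal I"
proof -
  let ?c = "of_nat (Poly_Mapping.lookup u i) :: 'k"
  have "partial_deriv i (mon u) \<in> deriv_ideal I"
    using assms(1) unfolding deriv_ideal_def by (blast intro: ideal.span_base)
  then have "Poly_Mapping.single 0 (inverse ?c) * partial_deriv i (mon u) \<in> deriv_ideal I"
    unfolding deriv_ideal_def by (rule ideal.span_scale)
  then show ?thesis using assms(2) by (simp add: partial_deriv_mon mult_single)
qed

definition drop_var :: "'n \<Rightarrow> ('n \<Rightarrow>\<^sub>0 nat) \<Rightarrow> ('n \<Rightarrow>\<^sub>0 nat)" where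
  "drop_var i u = u - Poly_Mapping.single i (Poly_Mapping.lookup u i)"

lemma lookup_drop_var:
  "Poly_Mapping.lookup (drop_var i u) j = (if j = i then 0 else Poly_Mapping.lookup u j)"
  by (simp add: drop_var_def lookup_minus lookup_single when_def)

lemma drop_var_add: "drop_var i (u + v) = drop_var i u + drop_var i v"
  by (rule poly_mapping_eqI) (simp add: lookup_drop_var lookup_add)

lemma drop_var_exponent_multiple:
  "drop_var i (exponent_multiple n u) = exponent_multiple n (drop_var i u)"
  by (rule poly_mapping_eqI) (simp add: lookup_drop_var lookup_exponent_multiple)

text \<open>
  The truncated subtraction makes the right-hand side the whole ring for exponents at least 2. The
  strongly Golod property is used when the exponent is 1, where \<open>X\<^bsup>drop_var i u\<^esup>\<close> is a derivative of
  \<open>X\<^sup>u\<close> and its square lies in \<open>\<partial>(I)\<^sup>2\<close>.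
\<close>

lemma drop_var_square_mem_generator:
  fixes I :: "('n, 'k::field_char_0) mpoly set"
  assumes I: "ideal.subspace I" and golod: "ideal_power (deriv_ideal I) 2 \<subseteq> I"
    and u: "mon u \<in> I"
  shows "mon (drop_var i u) ^ 2 \<in> ideal_power I (2 - Poly_Mapping.lookup u i)"
proof -
  consider "Poly_Mapping.lookup u i = 0" | "Poly_Mapping.lookup u i = 1" | "2 \<le> Poly_Mapping.lookup u i"
    by linarith
  then show ?thesis
  proof cases
    case 1
    then have "drop_var i u = u" by (simp add: drop_var_def)
    then show ?thesis
      using u 1 I by (simp add: square_mem_ideal_power_two)
  next
    case 2
    then have "mon (drop_var i u) \<in> deriv_ideal I"
      using mon_diff_mem_deriv_ideal[OF u, of i] by (simp add: drop_var_def)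
    then have "mon (drop_var i u) ^ 2 \<in> ideal_power (deriv_ideal I) 2"
      by (simp add: square_mem_ideal_power_two deriv_ideal_def)
    then show ?thesis using golod 2 I by (auto simp: ideal_prod_UNIV_right)
  qed simp
qed

text \<open>
  A monomial of \<open>I\<^sup>r\<close> is a product of \<open>r\<close> monomials of \<open>I\<close>, to each of which the previous lemma applies;
  the exponents of \<open>x\<^sub>i\<close> in the factors add up.
\<close>

lemma drop_var_square_mem:
  fixes I :: "('n, 'k::field_char_0) mpoly set"
  assumes I: "monomial_ideal I" and golod: "ideal_power (deriv_ideal I) 2 \<subseteq> I"
    and b: "mon b \<in> ideal_power I r"
  shows "mon (drop_var i b) ^ 2 \<in> ideal_power I (2 * r - Poly_Mapping.lookup b i)"
  using b
proof (induction r arbitrary: b)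
  case (Suc r)
  obtain u v where b: "b = u + v" and u: "mon u \<in> I" and v: "mon v \<in> ideal_power I r"
    using mon_mem_ideal_power_Suc[OF I Suc.prems] .
  have subI: "ideal.subspace I" using I by (simp add: monomial_ideal_iff)
  have "mon (drop_var i b) ^ 2 = mon (drop_var i u) ^ 2 * (mon (drop_var i v) ^ 2 :: ('n, 'k) mpoly)"
    by (simp only: b drop_var_add mon_add power_mult_distrib)
  also have "\<dots> \<in> ideal_power I
      ((2 - Poly_Mapping.lookup u i) + (2 * r - Poly_Mapping.lookup v i))"
    by (intro mult_mem_ideal_power drop_var_square_mem_generator[OF subI golod u] Suc.IH[OF v])
  finally show ?case
    by (rule subsetD[OF ideal_power_antimono, rotated]) (simp add: b lookup_add)
qed simp

text \<open>
  This is \<open>\<partial>(I\<^bsup>p/q\<^esup>) \<subseteq> I\<^bsup>p/q - 1/2\<^esup>\<close> for monomials. With \<open>\<alpha> \<ge> 1\<close> the exponent of \<open>x\<^sub>i\<close> in \<open>X\<^sup>a\<close>, one has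
  \<open>\<alpha> (a - e\<^sub>i) = drop_var i a + (\<alpha> - 1) a\<close>, where the first summand lies in \<open>I\<^bsup>p/q - \<alpha>/2\<^esup>\<close> and the second one
  in \<open>I\<^bsup>(\<alpha> - 1)p/q\<^esup>\<close>. The product lies in \<open>I\<^bsup>\<alpha>(p/q - 1/2)\<^esup>\<close>, and dividing by \<open>\<alpha>\<close> gives the claim. The
  proof multiplies all exponents by \<open>2 q m\<close> to stay with natural numbers.
\<close>

lemma mon_diff_mem_rational_power:
  fixes I :: "('n, 'k::field_char_0) mpoly set"
  assumes I: "monomial_ideal I" and golod: "ideal_power (deriv_ideal I) 2 \<subseteq> I"
    and a: "mon a \<in> rational_power I p q" and pos: "0 < Poly_Mapping.lookup a i"
  shows "mon (a - Poly_Mapping.single i 1) \<in> rational_power I (2 * p - q) (2 * q)"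
proof -
  obtain m where m: "0 < m" and mem: "mon a ^ (q * m) \<in> ideal_power I (p * m)"
    using a I by (auto simp: mon_mem_rational_power_iff)
  define \<alpha> where "\<alpha> = Poly_Mapping.lookup a i"
  let ?b = "exponent_multiple (q * m) a" and ?c = "a - Poly_Mapping.single i 1"
  have "(mon (drop_var i a) ^ (q * m)) ^ 2 \<in> ideal_power I (2 * (p * m) - q * m * \<alpha>)"
    using drop_var_square_mem[OF I golod, of ?b "p * m" i] mem
    by (simp add: mon_exponent_multiple drop_var_exponent_multiple lookup_exponent_multiple \<alpha>_def)
  moreover have "(mon a ^ (q * m)) ^ (2 * (\<alpha> - 1)) \<in> ideal_power I (p * m * (2 * (\<alpha> - 1)))"
    by (rule power_mem_ideal_power[OF mem])
  ultimately have "(mon (drop_var i a) ^ (q * m)) ^ 2 * (mon a ^ (q * m)) ^ (2 * (\<alpha> - 1))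
      \<in> ideal_power I ((2 * (p * m) - q * m * \<alpha>) + p * m * (2 * (\<alpha> - 1)))"
    by (rule mult_mem_ideal_power)
  also have "(mon (drop_var i a) ^ (q * m)) ^ 2 * (mon a ^ (q * m)) ^ (2 * (\<alpha> - 1))
      = (mon ?c ^ (2 * q * (m * \<alpha>)) :: ('n, 'k) mpoly)"
  proof -
    have "exponent_multiple \<alpha> ?c = drop_var i a + exponent_multiple (\<alpha> - 1) a"
    proof (rule poly_mapping_eqI)
      fix j
      show "Poly_Mapping.lookup (exponent_multiple \<alpha> ?c) j =
          Poly_Mapping.lookup (drop_var i a + exponent_multiple (\<alpha> - 1) a) j"
        using pos unfolding \<alpha>_def
        by (cases "Poly_Mapping.lookup a i")
          (auto simp: lookup_exponent_multiple lookup_drop_var lookup_add lookup_minus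
            lookup_single when_def)
    qed
    then have "mon ?c ^ \<alpha> = mon (drop_var i a) * (mon a ^ (\<alpha> - 1) :: ('n, 'k) mpoly)"
      by (metis mon_exponent_multiple mon_add)
    then have "(mon ?c ^ \<alpha>) ^ (2 * (q * m)) =
        (mon (drop_var i a) * (mon a ^ (\<alpha> - 1) :: ('n, 'k) mpoly)) ^ (2 * (q * m))"
      by (rule arg_cong)
    then show ?thesis
      by (simp add: power_mult_distrib mult_ac flip: power_mult)
  qed
  finally have "mon ?c ^ (2 * q * (m * \<alpha>)) \<in>
      ideal_power I ((2 * (p * m) - q * m * \<alpha>) + p * m * (2 * (\<alpha> - 1)))" .
  moreover have "(2 * p - q) * (m * \<alpha>) \<le> (2 * (p * m) - q * m * \<alpha>) + p * m * (2 * (\<alpha> - 1))"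
  proof -
    obtain \<beta> where "\<alpha> = Suc \<beta>" using pos unfolding \<alpha>_def by (cases "Poly_Mapping.lookup a i") auto
    then have "(2 * p - q) * (m * \<alpha>) = 2 * (p * m) + p * m * (2 * \<beta>) - q * m * \<alpha>"
      by (simp add: diff_mult_distrib algebra_simps)
    then show ?thesis using \<open>\<alpha> = Suc \<beta>\<close> by simp
  qed
  ultimately have "mon ?c ^ (2 * q * (m * \<alpha>)) \<in> ideal_power I ((2 * p - q) * (m * \<alpha>))"
    using ideal_power_antimono by blast
  moreover have "0 < m * \<alpha>" using m pos by (simp add: \<alpha>_def)
  ultimately show ?thesis unfolding mon_mem_rational_power_iff[OF I] by blast
qed

text \<open>
  This is \<open>I\<^bsup>r/s\<^esup> I\<^bsup>r/s\<^esup> \<subseteq> I\<^bsup>p/q\<^esup>\<close> for monomials, where \<open>2 r/s \<ge> p/q\<close>.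
\<close>

lemma mon_add_mem_rational_power:
  fixes I :: "('n, 'k::comm_ring_1) mpoly set"
  assumes I: "monomial_ideal I" and le: "p * s \<le> 2 * r * q"
    and u: "mon u \<in> rational_power I r s" and v: "mon v \<in> rational_power I r s"
    and s: "0 < s"
  shows "mon (u + v) \<in> rational_power I p q"
proof -
  obtain m where m: "0 < m" and mu: "mon u ^ (s * m) \<in> ideal_power I (r * m)"
    using u by (auto simp: mon_mem_rational_power_iff[OF I])
  obtain n where n: "0 < n" and nv: "mon v ^ (s * n) \<in> ideal_power I (r * n)"
    using v by (auto simp: mon_mem_rational_power_iff[OF I])
  have "(mon u ^ (s * m)) ^ (n * q) * (mon v ^ (s * n)) ^ (m * q) \<in>
      ideal_power I (r * m * (n * q) + r * n * (m * q))"
    by (intro mult_mem_ideal_power power_mem_ideal_power mu nv)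
  also have "(mon u ^ (s * m)) ^ (n * q) * (mon v ^ (s * n)) ^ (m * q) =
      (mon (u + v) ^ (q * (s * m * n)) :: ('n, 'k) mpoly)"
    by (simp only: mon_add power_mult_distrib) (simp add: mult_ac flip: power_mult)
  also have "ideal_power I (r * m * (n * q) + r * n * (m * q)) \<subseteq> ideal_power I (p * (s * m * n))"
  proof (rule ideal_power_antimono)
    have "p * (s * m * n) = p * s * (m * n)" by (simp add: mult_ac)
    also have "\<dots> \<le> 2 * r * q * (m * n)" using le by (rule mult_le_mono1)
    also have "\<dots> = r * m * (n * q) + r * n * (m * q)" by (simp add: algebra_simps)
    finally show "p * (s * m * n) \<le> r * m * (n * q) + r * n * (m * q)" .
  qed
  finally show ?thesis
    unfolding mon_mem_rational_power_iff[OF I] using m n s by (intro exI[of _ "s * m * n"]) auto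
qed

lemma deriv_rational_power_square_subset:
  fixes I :: "('n, 'k::field_char_0) mpoly set"
  assumes I: "monomial_ideal I" and golod: "ideal_power (deriv_ideal I) 2 \<subseteq> I"
    and q: "0 < q" and le: "q \<le> p"
  shows "ideal_power (deriv_ideal (rational_power I p q)) 2 \<subseteq> rational_power I p q"
proof -
  let ?J = "rational_power I p q" and ?K = "rational_power I (2 * p - q) (2 * q)"
  have J: "monomial_ideal ?J" and K: "monomial_ideal ?K"
    using monomial_ideal_rational_power[OF I] q by auto
  have "partial_deriv i f \<in> ?K" if f: "f \<in> ?J" for f i
  proof -
    have "partial_deriv i f \<in> supported_on (\<lambda>u. mon u \<in> ?K)"
      using J f mon_diff_mem_rational_power[OF I golod]
      by (auto simp: monomial_ideal_iff supported_on_def elim!: keys_partial_deriv)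
    then show ?thesis using supported_on_mem_subset[of ?K] K by (auto simp: monomial_ideal_iff)
  qed
  then have deriv: "deriv_ideal ?J \<subseteq> ?K"
    unfolding deriv_ideal_def using K by (intro ideal.span_minimal) (auto simp: monomial_ideal_iff)
  have "mon (u + v) \<in> ?J" if "mon u \<in> ?K" "mon v \<in> ?K" for u v
  proof (rule mon_add_mem_rational_power[OF I _ that])
    have "2 * p \<le> 2 * (2 * p - q)" using le by simp
    then show "p * (2 * q) \<le> 2 * (2 * p - q) * q"
      using mult_le_mono1[of "2 * p" _ q] by (simp add: mult_ac)
  qed (use q in simp)
  then have "supported_on (\<lambda>w. \<exists>u v. w = u + v \<and> mon u \<in> ?K \<and> mon v \<in> ?K)
      \<subseteq> supported_on (\<lambda>w. mon w \<in> ?J)"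
    by (auto simp: supported_on_def)
  also have "\<dots> \<subseteq> ?J"
    using J by (intro supported_on_mem_subset) (simp add: monomial_ideal_iff)
  finally have "ideal_prod ?K ?K \<subseteq> ?J" using ideal_prod_supported[OF K K] by (rule order_trans[rotated])
  moreover have "ideal_prod (deriv_ideal ?J) (deriv_ideal ?J) \<subseteq> ideal_prod ?K ?K"
    using deriv by (intro ideal_prod_least subspace_ideal_prod ideal_prod_mem) auto
  ultimately show ?thesis by (simp add: ideal_power_two deriv_ideal_def)
qed

lemma monomial_ideal_homogeneous:
  assumes "monomial_ideal I"
  shows "homogeneous_ideal d I"
proof -
  obtain M where "I = ideal.span (mon ` M)" using assms by (auto simp: monomial_ideal_def)
  then show ?thesis
    unfolding homogeneous_ideal_def homogeneous_def by (intro exI[of _ "mon ` M"]) auto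
qed

lemma rational_power_proper:
  fixes I :: "('n, 'k::comm_ring_1) mpoly set"
  assumes I: "monomial_ideal I" and proper: "I \<noteq> UNIV" and p: "0 < p"
  shows "rational_power I p q \<noteq> UNIV"
proof
  assume "rational_power I p q = UNIV"
  then have "mon 0 \<in> rational_power I p q" by blast
  then obtain m where m: "0 < m" "(1 :: ('n, 'k) mpoly) \<in> ideal_power I (p * m)"
    unfolding mon_mem_rational_power_iff[OF I] by auto
  have sub: "ideal.subspace I" using I by (simp add: monomial_ideal_iff)
  have "ideal_power I (p * m) \<subseteq> I"
    using ideal_power_antimono[of 1 "p * m" I] m p by (simp add: ideal_prod_UNIV_right sub Suc_leI)
  then have "1 \<in> I" using m(2) by blast
  then have "x \<in> I" for x using ideal.subspace_scale[OF sub, of 1 x] by simp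
  then show False using proper by blast
qed

theorem theorem3p5:
  fixes d :: "'n::finite \<Rightarrow> nat"
    and I :: "('n, 'k::field_char_0) mpoly set"
    and p q :: nat
  assumes "\<And>i. 0 < d i"
    and "monomial_ideal I"
    and "strongly_golod d I"
    and "0 < p" and "0 < q" and "q \<le> p"
  shows "strongly_golod d (rational_power I p q)"
  unfolding strongly_golod_def
proof (intro conjI)
  have I: "I \<noteq> UNIV" and golod: "ideal_power (deriv_ideal I) 2 \<subseteq> I"
    using assms(3) by (auto simp: strongly_golod_def)
  show "ideal.subspace (rational_power I p q)"
    by (rule subspace_rational_power[OF \<open>0 < q\<close>])
  show "rational_power I p q \<noteq> UNIV"
    by (rule rational_power_proper[OF assms(2) I \<open>0 < p\<close>])
  show "homogeneous_ideal d (rational_power I p q)"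
    by (intro monomial_ideal_homogeneous monomial_ideal_rational_power assms)
  show "ideal_power (deriv_ideal (rational_power I p q)) 2 \<subseteq> rational_power I p q"
    by (rule deriv_rational_power_square_subset[OF assms(2) golod \<open>0 < q\<close> \<open>q \<le> p\<close>])
qed

end
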